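(* Let $r\ge 2$. Let $G=(V,E)$ be a finite simple graph containing no copy of $K_{r+1}$ as a subgraph, and let $1\le k\le |V|$. Then \[ \varepsilon_k(G)\le \left(1-\frac1r\right)\frac{k^2}{2}+(4k-2)\sqrt{k}. \]
   Context: $K_{r+1}$ is the complete graph on $r+1$ vertices. The Laplacian matrix $L(G)\in\mathbb{R}^{V\times V}$ of a graph $G=(V,E)$ has $L(G)_{u,u}=\deg(u)$, $L(G)_{u,v}=-1$ if $\{u,v\}\in E$, and $0$ otherwise. For a symmetric matrix $M$, $\lambda_i(M)$ denotes its $i$-th largest eigenvalue. Define $\varepsilon_k(G)=\sum_{i=1}^k\lambda_i(L(G))-|E|$. *)

theory Defs
  imports "HOL-Analysis.Analysis" "HOL-Computational_Algebra.Polynomial"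
begin

text \<open>
  The vertex set of a graph is the whole of a finite type \<open>'v\<close>, so a graph is given by its
  set of edges, and \<open>|V|\<close> is \<open>CARD('v)\<close>.
\<close>

definition simple_graph :: "'v::finite set set \<Rightarrow> bool" where
  "simple_graph E \<longleftrightarrow> (\<forall>e\<in>E. card e = 2)"

definition vertex_degree :: "'v::finite set set \<Rightarrow> 'v \<Rightarrow> nat" where
  "vertex_degree E u = card {e \<in> E. u \<in> e}"

text \<open>A (not necessarily induced) copy of the complete graph on \<open>m\<close> vertices.\<close>

definition contains_complete :: "'v::finite set set \<Rightarrow> nat \<Rightarrow> bool" where
  "contains_complete E m \<longleftrightarrow>
     (\<exists>W. card W = m \<and> (\<forall>u\<in>W. \<forall>v\<in>W. u \<noteq> v \<longrightarrow> {u, v} \<in> E))"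

definition laplacian :: "'v::finite set set \<Rightarrow> real ^ 'v ^ 'v" where
  "laplacian E = (\<chi> u v. if u = v then real (vertex_degree E u)
                          else if {u, v} \<in> E then - 1 else 0)"

definition charpoly :: "real ^ 'n ^ 'n \<Rightarrow> real poly" where
  "charpoly M = det (\<chi> i j. (if i = j then [:0, 1:] else 0) - [:M $ i $ j:])"

text \<open>
  The \<open>i\<close>-th largest eigenvalue, counted with multiplicity and indexed from 1. It is meant for
  symmetric \<open>M\<close>, whose characteristic polynomial splits over the reals, and for
  \<open>1 \<le> i \<le> CARD('n)\<close>.
\<close>

definition nth_largest_eigenvalue :: "nat \<Rightarrow> real ^ 'n ^ 'n \<Rightarrow> real" where
  "nth_largest_eigenvalue i M = rev (sorted_list_of_multiset (proots (charpoly M))) ! (i - 1)"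

definition laplacian_excess :: "nat \<Rightarrow> 'v::finite set set \<Rightarrow> real" where
  "laplacian_excess k E =
     (\<Sum>i=1..k. nth_largest_eigenvalue i (laplacian E)) - real (card E)"

end

theory Submission
  imports Defs
begin

text \<open>
  Let \<open>P\<close> be the orthogonal projection onto the span of eigenvectors for the \<open>k\<close> largest
  eigenvalues and \<open>p\<^sub>u = P\<^sub>u\<^sub>u\<close>, so that \<open>0 \<le> p\<^sub>u \<le> 1\<close>, \<open>\<Sum>\<^sub>u p\<^sub>u = k\<close> and
  \<open>\<Sum>\<^sub>v P\<^sub>u\<^sub>v\<^sup>2 = p\<^sub>u\<close>. The excess is the trace of \<open>P L\<close> minus \<open>|E|\<close>, that is, the sum over the
  edges \<open>uv\<close> of
  \<open>p\<^sub>u + p\<^sub>v - 1 - 2 P\<^sub>u\<^sub>v = p\<^sub>u p\<^sub>v + (- 2 P\<^sub>u\<^sub>v - (1 - p\<^sub>u) (1 - p\<^sub>v))\<close>.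
  By the Motzkin--Straus inequality the first summands contribute at most
  \<open>(1 - 1/r) k\<^sup>2 / 2\<close>. For the second ones call \<open>u\<close> heavy if \<open>p\<^sub>u > 1/2\<close>; there are at
  most \<open>2k - 1\<close> heavy vertices. If \<open>v\<close> is not heavy, AM-GM bounds the second summand by
  \<open>2 P\<^sub>u\<^sub>v\<^sup>2 / (1 - p\<^sub>u)\<close>, and these add up to at most \<open>2k\<close>. Over pairs of heavy vertices
  Cauchy--Schwarz gives at most \<open>(2k - 2) \<surd>k\<close>.
\<close>

subsection \<open>Eigenvalues of symmetric matrices\<close>

text \<open>A maximiser \<open>v\<close> of \<open>x \<bullet> f x\<close> over the unit sphere of
  \<open>S\<close> is an eigenvector: the first variation vanishes there, and invariance keeps the
  residual inside \<open>S\<close>.\<close>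

lemma selfadjoint_eigenvector_in_subspace:
  fixes f :: "'a::euclidean_space \<Rightarrow> 'a"
  assumes "linear f" and adj: "\<And>x y. f x \<bullet> y = x \<bullet> f y"
    and S: "subspace S" "\<And>x. x \<in> S \<Longrightarrow> f x \<in> S" and "x \<in> S" "x \<noteq> 0"
  obtains v c where "v \<in> S" "norm v = 1" "f v = c *\<^sub>R v"
proof -
  interpret linear f by fact
  let ?T = "S \<inter> sphere 0 1"
  have "compact ?T"
    using S(1) by (simp add: closed_Int_compact closed_subspace)
  moreover have "(1 / norm x) *\<^sub>R x \<in> ?T"
    using assms by (simp add: subspace_scale)
  moreover have "continuous_on ?T (\<lambda>x. x \<bullet> f x)"
    by (intro continuous_intros linear_continuous_on linear_conv_bounded_linear[THEN iffD1] \<open>linear f\<close>)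
  ultimately obtain v where v: "v \<in> ?T" and max: "\<And>y. y \<in> ?T \<Longrightarrow> y \<bullet> f y \<le> v \<bullet> f v"
    using continuous_attains_sup by (metis empty_iff)
  define c where "c = v \<bullet> f v"
  \<comment> \<open>By maximality of \<open>c\<close> the quadratic form of \<open>g\<close> is
    nonnegative on \<open>S\<close>, and it vanishes at \<open>v\<close>.\<close>
  define g where "g = (\<lambda>w. c *\<^sub>R w - f w)"
  have vv: "v \<bullet> v = 1" "v \<in> S"
    using v by (auto simp: norm_eq_1)
  have nonneg: "0 \<le> w \<bullet> g w" if "w \<in> S" for w
  proof (cases "w = 0")
    case False
    have "(1 / norm w) *\<^sub>R w \<in> ?T"
      using False that S(1) by (simp add: subspace_scale)
    from max[OF this] have "(w \<bullet> f w) / (norm w)\<^sup>2 \<le> c"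
      by (simp add: c_def scale power2_eq_square)
    then have "w \<bullet> f w \<le> c * (norm w)\<^sup>2"
      using False by (simp add: divide_le_eq)
    then show ?thesis
      by (simp add: g_def inner_diff_right power2_norm_eq_inner)
  qed simp
  define y where "y = g v"
  have yS: "y \<in> S"
    using vv S by (simp add: y_def g_def subspace_diff subspace_scale)
  \<comment> \<open>Perturb \<open>v\<close> in the direction of the residual
    \<open>y = g v\<close>: the constant term is zero, so a small negative \<open>t\<close> would
    make the form negative unless \<open>y = 0\<close>.\<close>
  have "0 \<le> t\<^sup>2 * (y \<bullet> g y) + 2 * t * (y \<bullet> y)" for t
  proof -
    have "0 \<le> (v + t *\<^sub>R y) \<bullet> g (v + t *\<^sub>R y)"
      using vv yS S(1) by (intro nonneg) (simp add: subspace_add subspace_scale)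
    also have "\<dots> = v \<bullet> g v + t * (v \<bullet> g y + y \<bullet> g v) + t\<^sup>2 * (y \<bullet> g y)"
      by (simp add: g_def add scale algebra_simps inner_simps power2_eq_square)
    also have "v \<bullet> g v = 0"
      using vv by (simp add: g_def inner_simps c_def)
    also have "v \<bullet> g y = y \<bullet> g v"
      using adj[of v y] by (simp add: g_def inner_simps inner_commute)
    finally show ?thesis
      by (simp add: y_def algebra_simps)
  qed
  note quad = this
  have "y \<bullet> y = 0"
  proof (rule ccontr)
    assume "y \<bullet> y \<noteq> 0"
    then have pos: "y \<bullet> y > 0" by simp
    define a where "a = y \<bullet> g y"
    have a: "a \<ge> 0" unfolding a_def using yS by (rule nonneg)
    \<comment> \<open>The denominator \<open>a + 1\<close> stays positive even if
      \<open>a = 0\<close>; with this \<open>t\<close> the factor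
      \<open>t * a + 2 * (y \<bullet> y)\<close> equals \<open>y \<bullet> y - t\<close>, which is
      positive.\<close>
    define t where "t = - (y \<bullet> y) / (a + 1)"
    have "t * (a + 1) = - (y \<bullet> y)" using a by (simp add: t_def)
    moreover have "t < 0" using a pos by (simp add: t_def divide_less_0_iff)
    ultimately have "t * (t * a + 2 * (y \<bullet> y)) < 0"
      using pos by (intro mult_neg_pos) (simp_all add: algebra_simps del: inner_gt_zero_iff)
    then show False
      using quad[of t] by (simp add: a_def power2_eq_square algebra_simps)
  qed
  then have "f v = c *\<^sub>R v"
    by (simp add: y_def g_def)
  then show ?thesis
    using that v by auto
qed

text \<open>Take an orthonormal set of eigenvectors of maximal size. Self-adjointness makes its
  orthogonal complement invariant, so a nonzero complement would contain a further
  eigenvector.\<close>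

lemma selfadjoint_orthonormal_eigenbasis:
  fixes f :: "'a::euclidean_space \<Rightarrow> 'a"
  assumes "linear f" and adj: "\<And>x y. f x \<bullet> y = x \<bullet> f y"
  obtains B where "pairwise orthogonal B" "card B = DIM('a)"
    "\<And>b. b \<in> B \<Longrightarrow> norm b = 1" "\<And>b. b \<in> B \<Longrightarrow> \<exists>c. f b = c *\<^sub>R b"
proof -
  define Q where "Q = (\<lambda>B. pairwise orthogonal B \<and> (\<forall>b\<in>B. norm b = 1 \<and> (\<exists>c. f b = c *\<^sub>R b)))"
  have indep: "independent B" if "Q B" for B
    using that by (intro pairwise_orthogonal_independent) (auto simp: Q_def)
  have bound: "card B \<le> DIM('a)" if "Q B" for B
    using independent_bound[OF indep[OF that]] by simp
  have "Q {}" by (simp add: Q_def)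
  then have "\<exists>B. Q B \<and> (\<forall>C. Q C \<longrightarrow> card C \<le> card B)"
    by (rule ex_has_greatest_nat[where b = "Suc DIM('a)"]) (simp add: bound le_imp_less_Suc)
  then obtain B where B: "Q B" and max: "\<And>C. Q C \<Longrightarrow> card C \<le> card B"
    by auto
  have "card B = DIM('a)"
  proof (rule ccontr)
    assume "card B \<noteq> DIM('a)"
    then have "dim B < DIM('a)"
      using bound[OF B] dim_eq_card_independent[OF indep[OF B]] by simp
    then obtain x where x: "x \<noteq> 0" "\<And>y. y \<in> span B \<Longrightarrow> orthogonal x y"
      by (rule orthogonal_to_subspace_exists) blast
    define S where "S = {y. \<forall>b\<in>B. orthogonal b y}"
    have "subspace S"
      unfolding S_def by (rule subspace_orthogonal_to_vectors)
    moreover have "f y \<in> S" if "y \<in> S" for y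
      unfolding S_def
    proof (safe)
      fix b assume b: "b \<in> B"
      then obtain c where "f b = c *\<^sub>R b" using B by (auto simp: Q_def)
      then show "orthogonal b (f y)"
        using adj[of b y] that b by (simp add: orthogonal_def S_def)
    qed
    moreover have "x \<in> S"
      using x(2) by (auto simp: S_def orthogonal_commute span_base)
    ultimately obtain v c where v: "v \<in> S" "norm v = 1" "f v = c *\<^sub>R v"
      using selfadjoint_eigenvector_in_subspace[OF assms] x(1) by metis
    have "v \<notin> B"
      using v by (auto simp: S_def orthogonal_self)
    moreover have "Q (insert v B)"
      using B v by (auto simp: Q_def pairwise_insert S_def orthogonal_commute)
    moreover have "finite B"
      using B by (simp add: Q_def pairwise_orthogonal_imp_finite)
    ultimately show False
      using max[of "insert v B"] by simp
  qed
  then show ?thesis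
    using that B by (auto simp: Q_def)
qed

text \<open>Indexing the basis by \<open>'n\<close> itself lets the eigenvectors become the columns
  of a square matrix.\<close>

lemma symmetric_matrix_eigenbasis:
  fixes M :: "real ^ 'n ^ 'n"
  assumes "transpose M = M"
  obtains q :: "'n \<Rightarrow> real ^ 'n" and l :: "'n \<Rightarrow> real"
  where "\<And>i j. q i \<bullet> q j = (if i = j then 1 else 0)" "\<And>i. M *v q i = l i *\<^sub>R q i"
proof -
  have adj: "(M *v x) \<bullet> y = x \<bullet> (M *v y)" for x y
    by (metis assms dot_lmul_matrix transpose_matrix_vector)
  obtain B where B: "pairwise orthogonal B" "card B = DIM(real ^ 'n)"
    "\<And>b. b \<in> B \<Longrightarrow> norm b = 1" "\<And>b. b \<in> B \<Longrightarrow> \<exists>c. M *v b = c *\<^sub>R b"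
    using selfadjoint_orthonormal_eigenbasis[OF matrix_vector_mul_linear adj] by metis
  have "finite B" using B(1) by (rule pairwise_orthogonal_imp_finite)
  then obtain q where q: "bij_betw q (UNIV :: 'n set) B"
    using finite_same_card_bij[of "UNIV :: 'n set" B] B(2) by auto
  then have qB: "q i \<in> B" for i
    by (auto simp: bij_betw_def)
  have "q i \<bullet> q j = (if i = j then 1 else 0)" for i j
  proof (cases "i = j")
    case True
    then show ?thesis using B(3)[OF qB[of i]] by (simp add: norm_eq_1)
  next
    case False
    then have "q i \<noteq> q j"
      using q by (metis bij_betw_def UNIV_I inj_onD)
    then show ?thesis
      using B(1) qB False by (auto simp: pairwise_def orthogonal_def)
  qed
  moreover obtain l where "\<And>i. M *v q i = l i *\<^sub>R q i"
    using B(4)[OF qB] by metis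
  ultimately show ?thesis using that by blast
qed

text \<open>With the eigenvectors as columns of \<open>C\<close>, diagonalisation reads
  \<open>XM ** C = C ** D\<close> over the polynomial ring. Orthonormality gives
  \<open>det C \<noteq> 0\<close>, so \<open>det C\<close> cancels.\<close>

lemma charpoly_eigenbasis:
  fixes M :: "real ^ 'n ^ 'n" and q :: "'n \<Rightarrow> real ^ 'n"
  assumes q: "\<And>i j. q i \<bullet> q j = (if i = j then 1 else 0)" and eig: "\<And>i. M *v q i = l i *\<^sub>R q i"
  shows "charpoly M = (\<Prod>i\<in>UNIV. [:- l i, 1:])"
proof -
  define XM :: "real poly ^ 'n ^ 'n"
    where "XM = (\<chi> i j. (if i = j then [:0, 1:] else 0) - [:M $ i $ j:])"
  define C :: "real poly ^ 'n ^ 'n" where "C = (\<chi> u i. [:q i $ u:])"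
  define D :: "real poly ^ 'n ^ 'n" where "D = (\<chi> i j. if i = j then [:- l i, 1:] else 0)"
  have const_sum: "(\<Sum>k\<in>A. [:h k:]) = [:\<Sum>k\<in>A. h k:]" for h :: "'n \<Rightarrow> real" and A
    by (induction A rule: infinite_finite_induct) auto
  have Mq: "(\<Sum>k\<in>UNIV. M $ u $ k * q i $ k) = l i * q i $ u" for u i
    using arg_cong[OF eig[of i], of "\<lambda>x. x $ u"] by (simp add: matrix_vector_mult_def)
  have "XM ** C = C ** D"
  proof -
    have "(XM ** C) $ u $ i = (C ** D) $ u $ i" for u i
    proof -
      have "(XM ** C) $ u $ i
          = (\<Sum>k\<in>UNIV. (if u = k then [:0, 1:] * [:q i $ k:] else 0) - [:M $ u $ k * q i $ k:])"
        unfolding matrix_matrix_mult_def XM_def C_def by (simp, intro sum.cong) auto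
      also have "\<dots> = [:0, 1:] * [:q i $ u:] - [:l i * q i $ u:]"
        by (simp add: sum_subtractf const_sum Mq)
      also have "\<dots> = [:q i $ u:] * [:- l i, 1:]"
        by simp
      also have "\<dots> = (C ** D) $ u $ i"
        unfolding matrix_matrix_mult_def C_def D_def
        by (simp add: if_distrib[of "\<lambda>x. _ * x"] cong: if_cong)
      finally show ?thesis .
    qed
    then show ?thesis by (simp add: vec_eq_iff)
  qed
  then have "det XM * det C = det C * det D"
    by (metis det_mul)
  moreover have "det C \<noteq> 0"
  proof -
    have "(transpose C ** C) $ i $ j = (mat 1 :: real poly ^ 'n ^ 'n) $ i $ j" for i j
      using q[of i j]
      by (simp add: matrix_matrix_mult_def transpose_def C_def const_sum mat_def inner_vec_def
          one_pCons mult.commute)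
    then have "transpose C ** C = mat 1" by (simp add: vec_eq_iff)
    then have "det C * det C = 1" by (metis det_I det_mul det_transpose)
    then show ?thesis by auto
  qed
  ultimately have "det XM = det D" by simp
  also have "\<dots> = (\<Prod>i\<in>UNIV. [:- l i, 1:])"
    by (subst det_diagonal) (auto simp: D_def)
  finally show ?thesis by (simp add: charpoly_def XM_def)
qed

text \<open>Replaces the sorted list of roots by \<open>k\<close> orthonormal vectors, which turns
  the eigenvalue sum into the trace of \<open>M\<close> against a projection.\<close>

lemma sum_nth_largest_eigenvalues:
  fixes M :: "real ^ 'n ^ 'n"
  assumes "transpose M = M" "k \<le> CARD('n)"
  obtains I and q :: "'n \<Rightarrow> real ^ 'n" where "card I = k"
    "\<And>i j. q i \<bullet> q j = (if i = j then 1 else 0)"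
    "(\<Sum>i=1..k. nth_largest_eigenvalue i M) = (\<Sum>i\<in>I. q i \<bullet> (M *v q i))"
proof -
  obtain q :: "'n \<Rightarrow> real ^ 'n" and l where q: "\<And>i j. q i \<bullet> q j = (if i = j then 1 else 0)"
    and eig: "\<And>i. M *v q i = l i *\<^sub>R q i"
    using symmetric_matrix_eigenbasis[OF assms(1)] by metis
  have roots: "proots (charpoly M) = image_mset l (mset_set UNIV)"
  proof -
    have "(\<Sum>i\<in>A. {#l i#}) = image_mset l (mset_set A)" for A
      by (induction A rule: infinite_finite_induct) auto
    then show ?thesis
      unfolding charpoly_eigenbasis[OF q eig] by (subst proots_prod) auto
  qed
  obtain zs where zs: "set zs = (UNIV :: 'n set)" "distinct zs"
    using finite_distinct_list[of "UNIV :: 'n set"] by auto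
  \<comment> \<open>Sorting the indices instead of the eigenvalues keeps repeated eigenvalues
    attached to distinct indices, so that the last \<open>k\<close> entries form a set of size
    \<open>k\<close>.\<close>
  define ys where "ys = sort_key l zs"
  have ys: "set ys = UNIV" "distinct ys" "sorted (map l ys)" "mset ys = mset_set UNIV"
    using zs by (auto simp: ys_def mset_set_set[symmetric])
  have len: "length ys = CARD('n)"
    using ys(1,2) distinct_card by metis
  have "proots (charpoly M) = mset (map l ys)"
    using roots ys(4) by simp
  then have sorted: "sorted_list_of_multiset (proots (charpoly M)) = map l ys"
    using ys(3) by (simp add: sorted_list_of_multiset_mset sorted_sort_id del: mset_map)
  have "(\<Sum>i=1..k. nth_largest_eigenvalue i M) = (\<Sum>i<k. nth_largest_eigenvalue (Suc i) M)"
    by (rule sum.reindex_bij_witness[of _ Suc "\<lambda>i. i - 1"]) auto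
  also have "\<dots> = (\<Sum>i<k. l (rev ys ! i))"
    using assms(2) len
    by (intro sum.cong) (auto simp: nth_largest_eigenvalue_def sorted rev_map)
  also have "\<dots> = sum l ((!) (rev ys) ` {..<k})"
    using assms(2) len ys(2)
    by (subst sum.reindex) (auto simp: inj_on_def nth_eq_iff_index_eq)
  finally have eq: "(\<Sum>i=1..k. nth_largest_eigenvalue i M)
      = (\<Sum>i\<in>(!) (rev ys) ` {..<k}. q i \<bullet> (M *v q i))"
    by (simp add: eig q)
  have "card ((!) (rev ys) ` {..<k}) = k"
    using assms(2) len ys(2)
    by (subst card_image) (auto simp: inj_on_def nth_eq_iff_index_eq)
  then show ?thesis
    using that q eq by blast
qed

subsection \<open>The Motzkin--Straus inequality\<close>

text \<open>Induction on the size of the support of \<open>w\<close>. On a clique, Cauchy-Schwarz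
  over at most \<open>r\<close> vertices suffices; otherwise the weight of one of two nonadjacent
  support vertices moves to the other without lowering the form. Pairs are ordered, hence no factor
  1/2.\<close>

theorem motzkin_straus:
  fixes R :: "'v::finite \<Rightarrow> 'v \<Rightarrow> bool" and w :: "'v \<Rightarrow> real"
  assumes sym: "\<And>u v. R u v = R v u" and irrefl: "\<And>u. \<not> R u u"
    and clique: "\<And>W. (\<And>u v. u \<in> W \<Longrightarrow> v \<in> W \<Longrightarrow> u \<noteq> v \<Longrightarrow> R u v) \<Longrightarrow> card W \<le> r"
    and "r \<ge> 1" and "\<And>u. w u \<ge> 0"
  shows "(\<Sum>u\<in>UNIV. \<Sum>v\<in>UNIV. of_bool (R u v) * (w u * w v)) \<le> (1 - 1 / real r) * (sum w UNIV)\<^sup>2"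
  using assms(5)
proof (induction "card {u. w u \<noteq> 0}" arbitrary: w rule: less_induct)
  case less
  let ?f = "\<lambda>w :: 'v \<Rightarrow> real. \<Sum>u\<in>UNIV. \<Sum>v\<in>UNIV. of_bool (R u v) * (w u * w v)"
  define S where "S = {u. w u \<noteq> 0}"
  show ?case
  proof (cases "\<forall>u\<in>S. \<forall>v\<in>S. u \<noteq> v \<longrightarrow> R u v")
    case True
    have "(sum w UNIV)\<^sup>2 = (sum w S)\<^sup>2"
      by (rule arg_cong[where f = "\<lambda>x. x\<^sup>2"], rule sum.mono_neutral_right) (auto simp: S_def)
    also have "\<dots> \<le> (\<Sum>u\<in>S. (w u)\<^sup>2) * card S"
      using Cauchy_Schwarz_ineq_sum[of w "\<lambda>_. 1" S] by simp
    also have "\<dots> \<le> (\<Sum>u\<in>S. (w u)\<^sup>2) * r"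
      using clique[of S] True by (intro mult_left_mono sum_nonneg) auto
    also have "(\<Sum>u\<in>S. (w u)\<^sup>2) = (\<Sum>u\<in>UNIV. (w u)\<^sup>2)"
      by (rule sum.mono_neutral_left) (auto simp: S_def)
    finally have *: "(sum w UNIV)\<^sup>2 / r \<le> (\<Sum>u\<in>UNIV. (w u)\<^sup>2)"
      using \<open>r \<ge> 1\<close> by (simp add: divide_le_eq)
    have "?f w \<le> (\<Sum>u\<in>UNIV. \<Sum>v\<in>UNIV. w u * w v - (if u = v then (w u)\<^sup>2 else 0))"
      using less.prems irrefl by (intro sum_mono) (auto simp: power2_eq_square)
    also have "\<dots> = (sum w UNIV)\<^sup>2 - (\<Sum>u\<in>UNIV. (w u)\<^sup>2)"
      by (simp add: sum_subtractf sum_product power2_eq_square)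
    finally show ?thesis
      using * by (simp add: algebra_simps)
  next
    case False
    \<comment> \<open>\<open>d x\<close> is the weight of the neighbours of \<open>x\<close>, half
      the partial derivative of the form at \<open>x\<close>; moving weight towards the larger value
      cannot hurt.\<close>
    define d where "d x = (\<Sum>y\<in>UNIV. of_bool (R x y) * w y)" for x
    obtain u v where uv: "u \<in> S" "v \<in> S" "u \<noteq> v" "\<not> R u v" "d v \<le> d u"
      using False sym by (metis linear)
    \<comment> \<open>Along the direction that moves weight from \<open>v\<close> to \<open>u\<close> the form is affine,
      because \<open>u\<close> and \<open>v\<close> are not adjacent.\<close>
    define w' where "w' = w(u := w u + w v, v := 0)"
    have shift: "(\<Sum>x\<in>UNIV. h x * w' x) = (\<Sum>x\<in>UNIV. h x * w x) + w v * (h u - h v)" for h :: "'v \<Rightarrow> real"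
    proof -
      have "(\<Sum>x\<in>UNIV. h x * w' x) = (\<Sum>x\<in>UNIV. h x * w x
          + ((if x = u then w v * h u else 0) - (if x = v then w v * h v else 0)))"
        using uv by (intro sum.cong) (auto simp: w'_def algebra_simps)
      then show ?thesis by (simp add: sum.distrib sum_subtractf right_diff_distrib)
    qed
    define d' where "d' x = (\<Sum>y\<in>UNIV. of_bool (R x y) * w' y)" for x
    have d': "d' x = d x + w v * (of_bool (R x u) - of_bool (R x v))" for x
      unfolding d'_def d_def by (rule shift)
    have form: "?f z = (\<Sum>x\<in>UNIV. (\<Sum>y\<in>UNIV. of_bool (R x y) * z y) * z x)" for z :: "'v \<Rightarrow> real"
      by (simp only: sum_distrib_right sum_distrib_left mult_ac)
    have col: "(\<Sum>x\<in>UNIV. of_bool (R x y) * w x) = d y" for y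
      unfolding d_def by (rule sum.cong[OF refl]) (subst sym, rule refl)
    have "(\<Sum>x\<in>UNIV. d' x * w x)
        = (\<Sum>x\<in>UNIV. d x * w x) + w v * ((\<Sum>x\<in>UNIV. of_bool (R x u) * w x) - (\<Sum>x\<in>UNIV. of_bool (R x v) * w x))"
      by (simp only: d' distrib_right sum.distrib sum_subtractf left_diff_distrib right_diff_distrib
          sum_distrib_left mult.assoc)
    also have "\<dots> = ?f w + w v * (d u - d v)"
      by (simp only: form col d_def[symmetric])
    \<comment> \<open>Each of the two arguments of the form contributes
      \<open>w v * (d u - d v)\<close>, since \<open>d'\<close> agrees with \<open>d\<close> at
      \<open>u\<close> and at \<open>v\<close>.\<close>
    finally have "?f w' = ?f w + 2 * w v * (d u - d v)"
      using uv irrefl sym[of u v] unfolding form[of w'] d'_def[symmetric] shift[of d'] by (simp add: d')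
    then have "?f w \<le> ?f w'"
      using uv less.prems by simp
    also have "\<dots> \<le> (1 - 1 / real r) * (sum w' UNIV)\<^sup>2"
    proof (rule less.hyps)
      \<comment> \<open>\<open>v\<close> leaves the support, and \<open>u\<close> was already in
        it.\<close>
      have "{x. w' x \<noteq> 0} \<subset> {x. w x \<noteq> 0}"
        using uv by (auto simp: w'_def S_def)
      then show "card {x. w' x \<noteq> 0} < card {x. w x \<noteq> 0}"
        by (intro psubset_card_mono) auto
    qed (use less.prems in \<open>auto simp: w'_def\<close>)
    also have "sum w' UNIV = sum w UNIV"
      using shift[of "\<lambda>_. 1"] by simp
    finally show ?thesis .
  qed
qed

subsection \<open>Sums of projection entries over a relation\<close>

text \<open>\<open>idem\<close> is the diagonal of \<open>P\<^sup>2 = P\<close> for symmetric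
  \<open>P\<close>. The outer factor 2 is there because every edge appears as two ordered
  pairs.\<close>

lemma projection_offdiagonal_sum_le:
  fixes P :: "'v::finite \<Rightarrow> 'v \<Rightarrow> real" and R :: "'v \<Rightarrow> 'v \<Rightarrow> bool"
  assumes sym: "\<And>u v. P u v = P v u" and idem: "\<And>u. (\<Sum>v\<in>UNIV. (P u v)\<^sup>2) = P u u"
    and trace: "(\<Sum>u\<in>UNIV. P u u) = real k" and "k \<ge> 1" and irrefl: "\<And>u. \<not> R u u"
  shows "(\<Sum>u\<in>UNIV. \<Sum>v\<in>UNIV. of_bool (R u v) * (- 2 * P u v - (1 - P u u) * (1 - P v v)))
    \<le> 2 * ((4 * real k - 2) * sqrt k)"
proof -
  define p where "p = (\<lambda>u. P u u)"
  have p0: "p u \<ge> 0" for u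
    unfolding p_def idem[symmetric] by (simp add: sum_nonneg)
  have off: "(\<Sum>v\<in>UNIV - {u}. (P u v)\<^sup>2) = p u * (1 - p u)" for u
    using idem[of u] by (simp add: sum_diff p_def power2_eq_square algebra_simps)
  have "0 \<le> p u * (1 - p u)" for u
    unfolding off[symmetric] by (simp add: sum_nonneg)
  then have p1: "p u \<le> 1" for u
    using p0[of u] by (smt (verit) zero_le_mult_iff)
  have vanish: "P u v = 0" if "p u = 1" "u \<noteq> v" for u v
  proof -
    have "(P u v)\<^sup>2 \<le> (\<Sum>v\<in>UNIV - {u}. (P u v)\<^sup>2)"
      using that by (intro member_le_sum) auto
    then show ?thesis using that by (simp add: off)
  qed
  define B where "B = {u. p u > 1 / 2}"
  \<comment> \<open>\<open>g u v\<close> pays for a pair whose second vertex is not heavy,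
    \<open>h u v\<close> for a pair of heavy ones. If \<open>p u = 1\<close>, division by zero makes
    \<open>g u v = 0\<close>, which is enough because \<open>P u v\<close> vanishes for
    \<open>u \<noteq> v\<close>.\<close>
  define g where "g = (\<lambda>u v. if u = v then 0 else 2 * (P u v)\<^sup>2 / (1 - p u))"
  define h where "h = (\<lambda>u v. if u \<in> B \<and> v \<in> B \<and> u \<noteq> v then 2 * \<bar>P u v\<bar> else 0)"
  have g0: "g u v \<ge> 0" for u v
    using p1 by (simp add: g_def)
  have h0: "h u v \<ge> 0" for u v
    by (simp add: h_def)
  have light: "- 2 * P u v - (1 - p u) * (1 - p v) \<le> g u v" if "u \<noteq> v" "v \<notin> B" for u v
  proof (cases "p u = 1")
    case True
    then show ?thesis using vanish that g0[of u v] by simp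
  next
    case False
    then have pu: "1 - p u > 0" using p1[of u] by simp
    have pv: "1 - p v \<ge> 1 / 2" using that by (simp add: B_def)
    \<comment> \<open>AM-GM in the form \<open>(P u v + a)\<^sup>2 \<ge> 0\<close>; the lower bound
      on \<open>a\<close> then removes \<open>p v\<close> from the denominator.\<close>
    define a where "a = (1 - p u) * (1 - p v)"
    have a: "a \<ge> (1 - p u) / 2" "a > 0"
      using pu pv mult_left_mono[OF pv, of "1 - p u"] by (auto simp: a_def)
    have "0 \<le> (P u v + a)\<^sup>2" by simp
    then have "(- 2 * P u v - a) * a \<le> (P u v)\<^sup>2"
      by (simp add: power2_eq_square algebra_simps)
    then have "- 2 * P u v - a \<le> (P u v)\<^sup>2 / a"
      using a by (simp add: le_divide_eq)
    also have "\<dots> \<le> (P u v)\<^sup>2 / ((1 - p u) / 2)"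
      using a pu by (intro divide_left_mono) auto
    finally show ?thesis
      using that by (simp add: g_def a_def mult.commute)
  qed
  \<comment> \<open>Both \<open>g u v\<close> and \<open>g v u\<close> appear because either
    endpoint may be the one that is not heavy; for two heavy endpoints the nonnegative product is
    dropped.\<close>
  have pointwise: "of_bool (R u v) * (- 2 * P u v - (1 - P u u) * (1 - P v v)) \<le> g u v + g v u + h u v" for u v
  proof (cases "R u v")
    case True
    then have "u \<noteq> v" using irrefl by auto
    have nn: "(1 - p u) * (1 - p v) \<ge> 0" using p1 by simp
    consider "v \<notin> B" | "u \<notin> B" | "u \<in> B" "v \<in> B" by blast
    then have "- 2 * P u v - (1 - p u) * (1 - p v) \<le> g u v + g v u + h u v"
    proof cases
      case 1
      then show ?thesis
        using light[OF \<open>u \<noteq> v\<close>] g0[of v u] h0[of u v] by simp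
    next
      case 2
      then show ?thesis
        using light[of v u] \<open>u \<noteq> v\<close> g0[of u v] h0[of u v] by (simp add: sym[of u v] mult.commute)
    next
      case 3
      then have "h u v = 2 * \<bar>P u v\<bar>" using \<open>u \<noteq> v\<close> by (simp add: h_def)
      then show ?thesis
        using nn g0[of u v] g0[of v u] by linarith
    qed
    then show ?thesis using True by (simp add: p_def)
  qed (use g0 h0 in \<open>simp add: add_nonneg_nonneg\<close>)
  have sum_g: "(\<Sum>u\<in>UNIV. \<Sum>v\<in>UNIV. g u v) \<le> 2 * k"
  proof -
    have "(\<Sum>v\<in>UNIV. g u v) \<le> 2 * p u" for u
    proof -
      have "(\<Sum>v\<in>UNIV. g u v) = (\<Sum>v\<in>UNIV - {u}. 2 * (P u v)\<^sup>2 / (1 - p u))"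
        by (rule sum.mono_neutral_cong_right) (auto simp: g_def)
      \<comment> \<open>The off-diagonal mass of row \<open>u\<close> carries the factor
        \<open>1 - p u\<close> and cancels the denominator; at \<open>p u = 1\<close> the quotient
        is 0.\<close>
      also have "\<dots> = 2 * (p u * (1 - p u)) / (1 - p u)"
        by (simp only: sum_divide_distrib[symmetric] sum_distrib_left[symmetric] off)
      also have "\<dots> \<le> 2 * p u"
        using p0[of u] by simp
      finally show ?thesis .
    qed
    then have "(\<Sum>u\<in>UNIV. \<Sum>v\<in>UNIV. g u v) \<le> (\<Sum>u\<in>UNIV. 2 * p u)"
      by (rule sum_mono)
    then show ?thesis
      using trace by (simp add: sum_distrib_left[symmetric] p_def)
  qed
  \<comment> \<open>The strict inequality in \<open>B\<close> gains the 1 in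
    \<open>2 * k - 1\<close>; it makes the heavy contribution vanish for
    \<open>k = 1\<close>.\<close>
  have card_B: "card B \<le> 2 * k - 1"
  proof (cases "B = {}")
    case False
    have "(\<Sum>u\<in>B. 1 / 2) < (\<Sum>u\<in>B. p u)"
      using False by (intro sum_strict_mono) (auto simp: B_def)
    also have "\<dots> \<le> (\<Sum>u\<in>UNIV. p u)"
      using p0 by (intro sum_mono2) auto
    finally have "real (card B) < 2 * real k"
      using trace by (simp add: p_def)
    then show ?thesis by linarith
  qed simp
  have sum_h: "(\<Sum>u\<in>UNIV. \<Sum>v\<in>UNIV. h u v) \<le> 2 * ((2 * real k - 2) * sqrt k)"
  proof -
    define D where "D = (SIGMA u:B. B - {u})"
    have "card D = card B * (card B - 1)"
      by (simp add: D_def card_SigmaI)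
    also have "\<dots> \<le> (2 * k - 1) * (2 * k - 1 - 1)"
      using card_B by (intro mult_mono diff_le_mono) auto
    finally have "real (card D) \<le> real ((2 * k - 1) * (2 * k - 1 - 1))"
      by (rule of_nat_mono)
    also have "\<dots> = (2 * real k - 1) * (2 * real k - 2)"
      using \<open>k \<ge> 1\<close> by (simp add: of_nat_diff)
    finally have card_D: "real (card D) \<le> (2 * real k - 1) * (2 * real k - 2)" .
    have "(\<Sum>(u,v)\<in>D. \<bar>P u v\<bar>\<^sup>2) = (\<Sum>u\<in>B. \<Sum>v\<in>B - {u}. (P u v)\<^sup>2)"
      by (simp add: D_def sum.Sigma)
    \<comment> \<open>For heavy \<open>u\<close> the off-diagonal mass
      \<open>p u * (1 - p u)\<close> of its row is at most \<open>p u / 2\<close>.\<close>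
    also have "\<dots> \<le> (\<Sum>u\<in>B. p u / 2)"
    proof (rule sum_mono)
      fix u assume "u \<in> B"
      have "(\<Sum>v\<in>B - {u}. (P u v)\<^sup>2) \<le> (\<Sum>v\<in>UNIV - {u}. (P u v)\<^sup>2)"
        by (intro sum_mono2) auto
      also have "\<dots> \<le> p u * (1 / 2)"
        unfolding off using \<open>u \<in> B\<close> p0 by (intro mult_left_mono) (auto simp: B_def)
      finally show "(\<Sum>v\<in>B - {u}. (P u v)\<^sup>2) \<le> p u / 2" by simp
    qed
    also have "\<dots> \<le> (\<Sum>u\<in>UNIV. p u / 2)"
      using p0 by (intro sum_mono2) auto
    also have "\<dots> = k / 2"
      using trace by (simp add: p_def sum_divide_distrib[symmetric])
    finally have squares: "(\<Sum>(u,v)\<in>D. \<bar>P u v\<bar>\<^sup>2) \<le> k / 2" .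
    have "(\<Sum>(u,v)\<in>D. \<bar>P u v\<bar>)\<^sup>2 \<le> (\<Sum>(u,v)\<in>D. \<bar>P u v\<bar>\<^sup>2) * card D"
      using Cauchy_Schwarz_ineq_sum[of "\<lambda>(u,v). \<bar>P u v\<bar>" "\<lambda>_. 1" D] by (simp add: case_prod_unfold)
    also have "\<dots> \<le> (k / 2) * ((2 * real k - 1) * (2 * real k - 2))"
      using squares card_D by (intro mult_mono) auto
    also have "\<dots> = k * ((2 * real k - 1) * (real k - 1))"
      by (simp add: algebra_simps)
    \<comment> \<open>After cancelling \<open>k - 1\<close> this is
      \<open>2 * k - 1 \<le> 4 * k - 4\<close>, true from \<open>k = 2\<close> on; for
      \<open>k = 1\<close> both sides are 0.\<close>
    also have "\<dots> \<le> k * (2 * real k - 2)\<^sup>2"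
    proof (cases "k = 1")
      case False
      then have "real k \<ge> 2" using \<open>k \<ge> 1\<close> by simp
      then have "(2 * real k - 1) * (real k - 1) \<le> (4 * real k - 4) * (real k - 1)"
        by (intro mult_right_mono) auto
      then show ?thesis
        by (intro mult_left_mono) (auto simp: power2_eq_square algebra_simps)
    qed simp
    also have "\<dots> = ((2 * real k - 2) * sqrt k)\<^sup>2"
      by (simp add: power_mult_distrib)
    finally have "(\<Sum>(u,v)\<in>D. \<bar>P u v\<bar>) \<le> (2 * real k - 2) * sqrt k"
      by (rule power2_le_imp_le) (use \<open>k \<ge> 1\<close> in simp)
    moreover have "(\<Sum>u\<in>UNIV. \<Sum>v\<in>UNIV. h u v) = (\<Sum>(u,v)\<in>D. 2 * \<bar>P u v\<bar>)"
      unfolding sum.cartesian_product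
      by (rule sum.mono_neutral_cong_right) (auto simp: h_def D_def split: if_splits)
    ultimately show ?thesis
      by (simp add: case_prod_unfold sum_distrib_left[symmetric])
  qed
  have "(\<Sum>u\<in>UNIV. \<Sum>v\<in>UNIV. of_bool (R u v) * (- 2 * P u v - (1 - P u u) * (1 - P v v)))
      \<le> (\<Sum>u\<in>UNIV. \<Sum>v\<in>UNIV. g u v + g v u + h u v)"
    by (intro sum_mono pointwise)
  also have "\<dots> = (\<Sum>u\<in>UNIV. \<Sum>v\<in>UNIV. g u v) + (\<Sum>u\<in>UNIV. \<Sum>v\<in>UNIV. g v u) + (\<Sum>u\<in>UNIV. \<Sum>v\<in>UNIV. h u v)"
    by (simp add: sum.distrib)
  also have "(\<Sum>u\<in>UNIV. \<Sum>v\<in>UNIV. g v u) = (\<Sum>u\<in>UNIV. \<Sum>v\<in>UNIV. g u v)"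
    by (rule sum.swap)
  also have "(\<Sum>u\<in>UNIV. \<Sum>v\<in>UNIV. g u v) + (\<Sum>u\<in>UNIV. \<Sum>v\<in>UNIV. g u v) + (\<Sum>u\<in>UNIV. \<Sum>v\<in>UNIV. h u v)
      \<le> 4 * k * 1 + 2 * ((2 * real k - 2) * sqrt k)"
    using sum_g sum_h by simp
  \<comment> \<open>The \<open>4 * k\<close> from the two sums of \<open>g\<close> is weakened by
    \<open>1 \<le> sqrt k\<close>, so that everything becomes a multiple of
    \<open>sqrt k\<close>.\<close>
  also have "\<dots> \<le> 4 * k * sqrt k + 2 * ((2 * real k - 2) * sqrt k)"
    using \<open>k \<ge> 1\<close> by (intro add_right_mono mult_left_mono) auto
  finally show ?thesis by (simp add: algebra_simps)
qed

subsection \<open>The Laplacian of a graph\<close>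

lemma vertex_degree_eq_card_neighbours:
  assumes "simple_graph E"
  shows "vertex_degree E u = card {v. {u, v} \<in> E}"
proof -
  have "bij_betw (\<lambda>v. {u, v}) {v. {u, v} \<in> E} {e \<in> E. u \<in> e}"
  proof (rule bij_betw_imageI)
    show "inj_on (\<lambda>v. {u, v}) {v. {u, v} \<in> E}"
      by (auto simp: inj_on_def doubleton_eq_iff)
    have "\<exists>v. e = {u, v}" if "e \<in> E" "u \<in> e" for e
    proof -
      have "card e = 2" using that assms by (auto simp: simple_graph_def)
      then show ?thesis using that by (auto simp: card_2_iff)
    qed
    then show "(\<lambda>v. {u, v}) ` {v. {u, v} \<in> E} = {e \<in> E. u \<in> e}" by fastforce
  qed
  then show ?thesis
    by (simp add: vertex_degree_def bij_betw_same_card)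
qed

lemma sum_vertex_degree:
  assumes "simple_graph E"
  shows "(\<Sum>u\<in>UNIV. vertex_degree E u) = 2 * card E"
proof -
  have "(\<Sum>u\<in>UNIV. vertex_degree E u) = (\<Sum>u\<in>UNIV. \<Sum>e\<in>E. of_bool (u \<in> e))"
    by (simp add: vertex_degree_def Int_def)
  also have "\<dots> = (\<Sum>e\<in>E. \<Sum>u\<in>UNIV. of_bool (u \<in> e))"
    by (rule sum.swap)
  also have "\<dots> = (\<Sum>e\<in>E. card e)"
    by simp
  also have "\<dots> = 2 * card E"
    using assms by (simp add: simple_graph_def)
  finally show ?thesis .
qed

theorem theorem1p5:
  fixes E :: "'v::finite set set" and r k :: nat
  assumes "r \<ge> 2"
    and "simple_graph E"
    and "\<not> contains_complete E (r + 1)"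
    and "1 \<le> k" and "k \<le> CARD('v)"
  shows "laplacian_excess k E
           \<le> (1 - 1 / real r) * ((real k)\<^sup>2 / 2) + (4 * real k - 2) * sqrt (real k)"
proof -
  define R where "R = (\<lambda>u v. {u, v} \<in> E)"
  define a :: "'v \<Rightarrow> 'v \<Rightarrow> real" where "a = (\<lambda>u v. of_bool (R u v))"
  have R_sym: "R u v = R v u" for u v
    by (simp add: R_def insert_commute)
  have R_irrefl: "\<not> R u u" for u
    using assms(2) by (auto simp: R_def simple_graph_def)
  \<comment> \<open>\<open>contains_complete\<close> asks for exactly \<open>r + 1\<close> vertices,
    so a larger clique is first cut down to that size.\<close>
  have clique: "card W \<le> r" if W: "\<And>u v. u \<in> W \<Longrightarrow> v \<in> W \<Longrightarrow> u \<noteq> v \<Longrightarrow> R u v" for W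
  proof (rule ccontr)
    assume "\<not> card W \<le> r"
    then have "r + 1 \<le> card W" by simp
    then obtain W' where "W' \<subseteq> W" "card W' = r + 1"
      by (rule obtain_subset_with_card_n)
    then have "contains_complete E (r + 1)"
      unfolding contains_complete_def using W by (intro exI[of _ W']) (auto simp: R_def)
    with assms(3) show False by simp
  qed
  have deg: "real (vertex_degree E u) = (\<Sum>v\<in>UNIV. a u v)" for u
    by (simp add: vertex_degree_eq_card_neighbours[OF assms(2)] a_def R_def)
  have edges: "(\<Sum>u\<in>UNIV. \<Sum>v\<in>UNIV. a u v) = 2 * real (card E)"
    using sum_vertex_degree[OF assms(2), THEN arg_cong, of real] by (simp add: deg)
  have "transpose (laplacian E) = laplacian E"
    by (simp add: transpose_def laplacian_def vec_eq_iff insert_commute)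
  then obtain I and q :: "'v \<Rightarrow> real ^ 'v" where I: "card I = k"
    and q: "\<And>i j. q i \<bullet> q j = (if i = j then 1 else 0)"
    and eig: "(\<Sum>i=1..k. nth_largest_eigenvalue i (laplacian E)) = (\<Sum>i\<in>I. q i \<bullet> (laplacian E *v q i))"
    by (rule sum_nth_largest_eigenvalues[OF _ assms(5)]) blast
  \<comment> \<open>The matrix of the orthogonal projection onto the span of the chosen
    eigenvectors; orthonormality collapses the double sum in \<open>P_idem\<close>.\<close>
  define P where "P = (\<lambda>u v. \<Sum>i\<in>I. q i $ u * q i $ v)"
  have P_sym: "P u v = P v u" for u v
    by (simp add: P_def mult.commute)
  have P_idem: "(\<Sum>v\<in>UNIV. (P u v)\<^sup>2) = P u u" for u
  proof -
    have "(\<Sum>v\<in>UNIV. (P u v)\<^sup>2) = (\<Sum>v\<in>UNIV. \<Sum>i\<in>I. \<Sum>j\<in>I. q i $ u * q j $ u * (q i $ v * q j $ v))"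
      by (simp add: P_def power2_eq_square sum_product mult_ac)
    also have "\<dots> = (\<Sum>i\<in>I. \<Sum>v\<in>UNIV. \<Sum>j\<in>I. q i $ u * q j $ u * (q i $ v * q j $ v))"
      by (rule sum.swap)
    also have "\<dots> = (\<Sum>i\<in>I. \<Sum>j\<in>I. \<Sum>v\<in>UNIV. q i $ u * q j $ u * (q i $ v * q j $ v))"
      by (intro sum.cong refl sum.swap)
    also have "\<dots> = (\<Sum>i\<in>I. \<Sum>j\<in>I. q i $ u * q j $ u * (q i \<bullet> q j))"
      by (simp add: sum_distrib_left inner_vec_def)
    also have "\<dots> = P u u"
      by (simp add: q P_def if_distrib[of "\<lambda>x. _ * x"] cong: if_cong)
    finally show ?thesis .
  qed
  have P_trace: "(\<Sum>u\<in>UNIV. P u u) = real k"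
  proof -
    have "(\<Sum>u\<in>UNIV. P u u) = (\<Sum>i\<in>I. q i \<bullet> q i)"
      unfolding P_def by (subst sum.swap) (simp add: inner_vec_def)
    then show ?thesis by (simp add: q I)
  qed
  have lap: "(\<Sum>i\<in>I. q i \<bullet> (laplacian E *v q i))
      = (\<Sum>u\<in>UNIV. \<Sum>v\<in>UNIV. a u v * (P u u - P u v))"
  proof -
    \<comment> \<open>The diagonal entry is the degree, that is, a row sum of \<open>a\<close>; the
      subtracted term vanishes on the diagonal because there are no loops.\<close>
    have entry: "laplacian E $ u $ v * P u v = (if u = v then (\<Sum>v\<in>UNIV. a u v) * P u u else 0) - a u v * P u v" for u v
      using R_irrefl[of u] by (auto simp: laplacian_def deg a_def R_def)
    have "(\<Sum>i\<in>I. q i \<bullet> (laplacian E *v q i))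
        = (\<Sum>i\<in>I. \<Sum>u\<in>UNIV. \<Sum>v\<in>UNIV. laplacian E $ u $ v * (q i $ u * q i $ v))"
      by (simp add: inner_vec_def matrix_vector_mult_def sum_distrib_left mult_ac)
    also have "\<dots> = (\<Sum>u\<in>UNIV. \<Sum>i\<in>I. \<Sum>v\<in>UNIV. laplacian E $ u $ v * (q i $ u * q i $ v))"
      by (rule sum.swap)
    also have "\<dots> = (\<Sum>u\<in>UNIV. \<Sum>v\<in>UNIV. \<Sum>i\<in>I. laplacian E $ u $ v * (q i $ u * q i $ v))"
      by (intro sum.cong refl sum.swap)
    also have "\<dots> = (\<Sum>u\<in>UNIV. \<Sum>v\<in>UNIV. laplacian E $ u $ v * P u v)"
      by (simp add: P_def sum_distrib_left)
    also have "\<dots> = (\<Sum>u\<in>UNIV. \<Sum>v\<in>UNIV. a u v * (P u u - P u v))"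
      by (simp add: entry sum_subtractf right_diff_distrib sum_distrib_right)
    finally show ?thesis .
  qed
  have a_sym: "a u v = a v u" for u v
    by (simp add: a_def R_sym)
  have "(\<Sum>u\<in>UNIV. \<Sum>v\<in>UNIV. a u v * (P u u - P u v)) = (\<Sum>u\<in>UNIV. \<Sum>v\<in>UNIV. a v u * (P v v - P v u))"
    by (rule sum.swap)
  also have "\<dots> = (\<Sum>u\<in>UNIV. \<Sum>v\<in>UNIV. a u v * (P v v - P u v))"
    by (intro sum.cong refl) (simp add: a_sym P_sym)
  finally have swap: "(\<Sum>u\<in>UNIV. \<Sum>v\<in>UNIV. a u v * (P u u - P u v))
      = (\<Sum>u\<in>UNIV. \<Sum>v\<in>UNIV. a u v * (P v v - P u v))" .
  \<comment> \<open>Doubling passes from edges to ordered pairs: the trace is written once with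
    \<open>P u u\<close> and once with \<open>P v v\<close>, which makes the summand symmetric in
    \<open>u\<close> and \<open>v\<close>.\<close>
  have "2 * laplacian_excess k E = (\<Sum>u\<in>UNIV. \<Sum>v\<in>UNIV. a u v * (P u u - P u v))
      + (\<Sum>u\<in>UNIV. \<Sum>v\<in>UNIV. a u v * (P v v - P u v)) - (\<Sum>u\<in>UNIV. \<Sum>v\<in>UNIV. a u v)"
    unfolding swap[symmetric] laplacian_excess_def eig lap edges by simp
  also have "\<dots> = (\<Sum>u\<in>UNIV. \<Sum>v\<in>UNIV. a u v * (P u u * P v v)
      + a u v * (- 2 * P u v - (1 - P u u) * (1 - P v v)))"
    unfolding sum.distrib[symmetric] sum_subtractf[symmetric]
    by (intro sum.cong refl) (simp add: algebra_simps)
  also have "\<dots> = (\<Sum>u\<in>UNIV. \<Sum>v\<in>UNIV. of_bool (R u v) * (P u u * P v v))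
      + (\<Sum>u\<in>UNIV. \<Sum>v\<in>UNIV. of_bool (R u v) * (- 2 * P u v - (1 - P u u) * (1 - P v v)))"
    by (simp only: sum.distrib a_def)
  also have "\<dots> \<le> (1 - 1 / real r) * (real k)\<^sup>2 + 2 * ((4 * real k - 2) * sqrt k)"
  proof (rule add_mono)
    have "P u u \<ge> 0" for u
      unfolding P_idem[symmetric] by (simp add: sum_nonneg)
    then show "(\<Sum>u\<in>UNIV. \<Sum>v\<in>UNIV. of_bool (R u v) * (P u u * P v v)) \<le> (1 - 1 / real r) * (real k)\<^sup>2"
      using motzkin_straus[of R r "\<lambda>u. P u u", OF R_sym R_irrefl clique] assms(1) by (simp add: P_trace)
    show "(\<Sum>u\<in>UNIV. \<Sum>v\<in>UNIV. of_bool (R u v) * (- 2 * P u v - (1 - P u u) * (1 - P v v)))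
        \<le> 2 * ((4 * real k - 2) * sqrt k)"
      using projection_offdiagonal_sum_le[OF P_sym P_idem P_trace assms(4) R_irrefl] .
  qed
  also have "\<dots> = 2 * ((1 - 1 / real r) * ((real k)\<^sup>2 / 2) + (4 * real k - 2) * sqrt k)"
    by (simp add: distrib_left)
  finally show ?thesis
    by (rule mult_left_le_imp_le) simp
qed

end
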